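(* For a positive integer $s$, let $f(s)$ be the number of positive integers $n$ for which there exists a positive integer $p$ such that the triple $(s,p,n)$ is admissible. Then $f(s)=0$ for $1\leq s\leq 11$, $f(s)=s-10$ for all $s\geq 19$, and $(f(12),f(13),f(14),f(15),f(16),f(17),f(18))=(1,2,4,4,6,7,7)$.
   Context: An $n$-partition of a positive integer $s$ is a multiset $\{x_1,\dots,x_n\}$ of $n$ positive integers with $x_1+\cdots+x_n=s$. For such a multiset define $T\{x_1,\dots,x_n\}=(s,p,n)$ where $s=x_1+\cdots+x_n$ and $p=x_1x_2\cdots x_n$. An ordered triple $(s,p,n)$ of positive integers is called admissible if there exist at least two different multisets $X$, $Y$ of $n$ positive integers with $T(X)=T(Y)=(s,p,n)$, i.e. sharing the same sum $s$, the same product $p$ and the same size $n$. *)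

theory Defs
  imports "HOL-Library.Multiset"
begin

definition T :: "nat multiset \<Rightarrow> nat \<times> nat \<times> nat" where
  "T X = (\<Sum>\<^sub># X, \<Prod>\<^sub># X, size X)"

definition admissible :: "nat \<times> nat \<times> nat \<Rightarrow> bool" where
  "admissible t \<longleftrightarrow>
     (case t of (s, p, n) \<Rightarrow> 0 < s \<and> 0 < p \<and> 0 < n) \<and>
     (\<exists>X Y. X \<noteq> Y \<and> (\<forall>x\<in>#X. 0 < x) \<and> (\<forall>y\<in>#Y. 0 < y) \<and> T X = t \<and> T Y = t)"

definition admissible_sizes :: "nat \<Rightarrow> nat set" where
  "admissible_sizes s = {n. 0 < n \<and> (\<exists>p>0. admissible (s, p, n))}"

definition f :: "nat \<Rightarrow> nat" where
  "f s = card (admissible_sizes s)"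

lemma size_le_sum_mset:
  fixes X :: "nat multiset"
  assumes "\<forall>x\<in>#X. 0 < x"
  shows "size X \<le> \<Sum>\<^sub># X"
  using assms by (induction X) auto

(* The set counted by f is finite, so the convention that card is 0 on infinite sets never applies. *)
lemma finite_admissible_sizes: "finite (admissible_sizes s)"
proof (rule finite_subset)
  show "admissible_sizes s \<subseteq> {..s}"
    using size_le_sum_mset by (auto simp: admissible_sizes_def admissible_def T_def)
qed simp

end

theory Submission
  imports Defs
begin

text \<open>
  Adjoining a part 1 to both multisets preserves a coincidence of sum and product and fixes
  the excess \<open>s - n\<close>, so for each excess \<open>d\<close> the admissible sizes form an up-set.
  An excess \<open>d \<le> 7\<close> never occurs: a multiset of excess \<open>d\<close> has at most \<open>d\<close> parts
  other than 1, so only the finitely many 7-partitions of \<open>7 + d\<close> matter. Sizes 1 and 2 never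
  occur either, since sum and product determine a pair. For excess \<open>d \<ge> 16\<close> size 3 already
  occurs, by the identity that \<open>{3(e + u), 2(e - u), e}\<close> and \<open>{2(e + u), e - u, 3e}\<close> have
  the same product and the same sum \<open>6e + u\<close>. For \<open>8 \<le> d \<le> 15\<close> the least size is 3, 4 or 5,
  which leaves five exceptional pairs \<open>(s, n)\<close>.
\<close>

section \<open>Coincidences of sum and product, and adjoining or removing parts 1\<close>

lemma admissible_sizesI:
  assumes "X \<noteq> Y" "\<forall>x\<in>#X. 0 < x" "\<forall>y\<in>#Y. 0 < y"
    and "\<Sum>\<^sub># X = s" "\<Sum>\<^sub># Y = s" "\<Prod>\<^sub># X = \<Prod>\<^sub># Y" "size X = n" "size Y = n"
  shows "n \<in> admissible_sizes s"
proof -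
  \<comment> \<open>Size 0 would make both multisets empty, hence equal.\<close>
  have n: "0 < n"
    using assms by (cases "n = 0") auto
  have "0 < s"
    using size_le_sum_mset[of X] assms n by auto
  moreover have "0 < \<Prod>\<^sub># X"
    using assms(2) by (induction X) auto
  ultimately show ?thesis
    using assms n unfolding admissible_sizes_def admissible_def T_def
    by (intro CollectI conjI exI[of _ "\<Prod>\<^sub># X"] exI[of _ X] exI[of _ Y]) auto
qed

text \<open>Sorted lists represent multisets uniquely, so for explicit witnesses every condition is
  a computation on numerals.\<close>

lemma admissible_sizes_listI:
  assumes "sorted xs" "sorted ys" "xs \<noteq> ys" "0 \<notin> set xs" "0 \<notin> set ys"
    and "sum_list xs = s" "sum_list ys = s" "prod_list xs = prod_list ys"
    and "length xs = n" "length ys = n"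
  shows "n \<in> admissible_sizes s"
proof (rule admissible_sizesI)
  show "mset xs \<noteq> mset ys"
    using assms(1-3) by (metis properties_for_sort sorted_sort_id)
  show "\<forall>x\<in>#mset xs. 0 < x" "\<forall>y\<in>#mset ys. 0 < y"
    using assms(4,5) by (metis gr0I set_mset_mset)+
qed (use assms in \<open>simp_all add: sum_mset_sum_list prod_mset_prod_list\<close>)

lemma admissible_sizesE:
  assumes "n \<in> admissible_sizes s"
  obtains X Y where "X \<noteq> Y" "\<forall>x\<in>#X. 0 < x" "\<forall>y\<in>#Y. 0 < y"
    "\<Sum>\<^sub># X = s" "\<Sum>\<^sub># Y = s" "\<Prod>\<^sub># X = \<Prod>\<^sub># Y" "size X = n" "size Y = n"
proof -
  obtain p X Y where "X \<noteq> Y" "\<forall>x\<in>#X. 0 < x" "\<forall>y\<in>#Y. 0 < y" "T X = (s, p, n)" "T Y = (s, p, n)"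
    using assms unfolding admissible_sizes_def admissible_def by blast
  then show thesis
    using that[of X Y] by (simp add: T_def)
qed

lemma admissible_sizes_add:
  assumes "n \<in> admissible_sizes s"
  shows "n + k \<in> admissible_sizes (s + k)"
proof (induction k)
  case (Suc k)
  obtain X Y where "X \<noteq> Y" "\<forall>x\<in>#X. 0 < x" "\<forall>y\<in>#Y. 0 < y"
    "\<Sum>\<^sub># X = s + k" "\<Sum>\<^sub># Y = s + k" "\<Prod>\<^sub># X = \<Prod>\<^sub># Y" "size X = n + k" "size Y = n + k"
    using Suc by (rule admissible_sizesE)
  then show ?case
    by (intro admissible_sizesI[of "add_mset 1 X" "add_mset 1 Y"]) auto
qed (use assms in simp)

lemma admissible_sizes_mono:
  assumes "m \<in> admissible_sizes (d + m)" "m \<le> n"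
  shows "n \<in> admissible_sizes (d + n)"
  using admissible_sizes_add[OF assms(1), of "n - m"] assms(2) by simp

text \<open>If all parts were at least 2, each would add at least 1 to the excess \<open>d\<close>,
  giving \<open>d\<close> at least \<open>size X\<close>.\<close>

lemma one_mem_if_excess_lt_size:
  fixes X :: "nat multiset"
  assumes "\<forall>x\<in>#X. 0 < x" "\<Sum>\<^sub># X = d + size X" "d < size X"
  shows "1 \<in># X"
proof (rule ccontr)
  assume "1 \<notin># X"
  with assms(1) have "\<forall>x\<in>#X. 2 \<le> x"
    by (metis One_nat_def Suc_1 Suc_leI le_neq_implies_less)
  then have "2 * size X \<le> \<Sum>\<^sub># X"
    by (induction X) auto
  with assms show False by simp
qed

lemma admissible_sizes_remove:
  assumes "n + k \<in> admissible_sizes (d + n + k)" "d \<le> n"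
  shows "n \<in> admissible_sizes (d + n)"
  using assms(1)
proof (induction k)
  case (Suc k)
  obtain X Y where XY: "X \<noteq> Y" "\<forall>x\<in>#X. 0 < x" "\<forall>y\<in>#Y. 0 < y"
    "\<Sum>\<^sub># X = d + n + Suc k" "\<Sum>\<^sub># Y = d + n + Suc k" "\<Prod>\<^sub># X = \<Prod>\<^sub># Y"
    "size X = n + Suc k" "size Y = n + Suc k"
    using Suc.prems by (rule admissible_sizesE)
  have "1 \<in># X" "1 \<in># Y"
    using XY assms(2) by (simp_all add: one_mem_if_excess_lt_size[where d = d, simplified])
  then obtain X' Y' where "X = add_mset 1 X'" "Y = add_mset 1 Y'"
    by (meson mset_add)
  with XY have "n + k \<in> admissible_sizes (d + n + k)"
    by (intro admissible_sizesI[of X' Y']) auto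
  then show ?case by (rule Suc.IH)
qed simp

section \<open>Enumeration of partitions and excess at most 7\<close>

text \<open>Lists are built in nondecreasing order, with \<open>m\<close> a lower bound for the
  entries. The first entry is the least, so it is at most the average, which bounds the search by
  \<open>s div Suc n\<close>.\<close>

fun parts :: "nat \<Rightarrow> nat \<Rightarrow> nat \<Rightarrow> nat list list" where
  "parts 0 m s = (if s = 0 then [[]] else [])"
| "parts (Suc n) m s =
    concat (map (\<lambda>x. map ((#) x) (parts n x (s - x))) [m..<Suc (s div Suc n)])"

text \<open>Completeness of the enumeration: with \<open>m = 1\<close>, a check over its output
  covers every multiset of positive parts.\<close>

lemma sorted_in_parts:
  assumes "sorted xs" "\<forall>x\<in>set xs. m \<le> x"
  shows "xs \<in> set (parts (length xs) m (sum_list xs))"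
  using assms
proof (induction xs arbitrary: m)
  case (Cons x xs)
  have "length xs * x \<le> sum_list xs"
    using sum_list_mono[of xs "\<lambda>_. x" "\<lambda>y. y"] Cons.prems
    by (simp add: sum_list_triv)
  then have "x * Suc (length xs) \<le> sum_list (x # xs)"
    by (simp add: mult.commute)
  then have "x \<le> sum_list (x # xs) div Suc (length xs)"
    by (simp only: less_eq_div_iff_mult_less_eq zero_less_Suc)
  then have "x \<in> set [m..<Suc (sum_list (x # xs) div Suc (length xs))]"
    using Cons.prems by (simp del: sum_list.Cons upt_Suc add: less_Suc_eq_le)
  moreover have "xs \<in> set (parts (length xs) x (sum_list (x # xs) - x))"
    using Cons by simp
  ultimately show ?case
    by (auto simp del: sum_list.Cons upt_Suc)
qed simp

declare parts.simps [simp del]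

text \<open>Distinct products over the enumeration mean that the product determines the partition,
  so non-admissibility becomes a finite computation.\<close>

lemma not_admissible_if_distinct:
  assumes "distinct (map prod_list (parts n 1 s))"
  shows "n \<notin> admissible_sizes s"
proof
  assume "n \<in> admissible_sizes s"
  then obtain X Y where XY: "X \<noteq> Y" "\<forall>x\<in>#X. 0 < x" "\<forall>y\<in>#Y. 0 < y"
    "\<Sum>\<^sub># X = s" "\<Sum>\<^sub># Y = s" "\<Prod>\<^sub># X = \<Prod>\<^sub># Y" "size X = n" "size Y = n"
    by (rule admissible_sizesE)
  have mem: "sorted_list_of_multiset Z \<in> set (parts n 1 s)"
    if "\<forall>x\<in>#Z. 0 < x" "\<Sum>\<^sub># Z = s" "size Z = n" for Z
    using sorted_in_parts[of "sorted_list_of_multiset Z" 1] that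
      sum_mset_sum_list[of "sorted_list_of_multiset Z"]
      size_mset[of "sorted_list_of_multiset Z"]
    by (simp add: Suc_le_eq del: size_mset)
  have prd: "prod_list (sorted_list_of_multiset Z) = \<Prod>\<^sub># Z" for Z :: "nat multiset"
    using prod_mset_prod_list[of "sorted_list_of_multiset Z"] by simp
  have "inj_on prod_list (set (parts n 1 s))"
    using assms by (simp add: distinct_map)
  then have "sorted_list_of_multiset X = sorted_list_of_multiset Y"
    using mem XY prd by (metis inj_onD)
  then have "X = Y"
    by (metis mset_sorted_list_of_multiset)
  with XY(1) show False by simp
qed

lemma not_admissible_excess_le_7:
  assumes "d \<le> 7"
  shows "n \<notin> admissible_sizes (d + n)"
proof
  assume "n \<in> admissible_sizes (d + n)"
  \<comment> \<open>Padding by seven ones first brings the size to at least 7 whatever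
    \<open>n\<close> is; ones are then stripped until the size is exactly 7.\<close>
  then have "n + 7 \<in> admissible_sizes (d + (n + 7))"
    by (rule admissible_sizes_mono) simp
  then have seven: "7 \<in> admissible_sizes (d + 7)"
    using admissible_sizes_remove[of 7 n d] assms by (simp add: ac_simps)
  have "\<forall>d \<in> set [0..<8]. distinct (map prod_list (parts 7 1 (d + 7)))"
    by code_simp
  then have "distinct (map prod_list (parts 7 1 (d + 7)))"
    by (rule bspec) (use assms in simp)
  then have "7 \<notin> admissible_sizes (d + 7)"
    by (rule not_admissible_if_distinct)
  with seven show False
    by contradiction
qed

section \<open>Sizes at most 2\<close>

lemma size_2_msetE:
  assumes "size M = 2"
  obtains a b where "M = {#a, b#}"
proof -
  obtain a N where M: "M = add_mset a N"
    using assms by (metis multiset_cases size_empty zero_neq_numeral)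
  then have "size N = 1"
    using assms by simp
  then obtain b where "N = {#b#}"
    by (blast dest: size_1_singleton_mset)
  then show thesis
    using M that by simp
qed

lemma not_admissible_size_le_2:
  assumes "n \<le> 2"
  shows "n \<notin> admissible_sizes s"
proof
  assume "n \<in> admissible_sizes s"
  then have "n + (2 - n) \<in> admissible_sizes (s + (2 - n))"
    by (rule admissible_sizes_add)
  then have "2 \<in> admissible_sizes (s + (2 - n))"
    using assms by simp
  then obtain X Y where XY: "X \<noteq> Y" "\<forall>x\<in>#X. 0 < x" "\<forall>y\<in>#Y. 0 < y"
    "\<Sum>\<^sub># X = s + (2 - n)" "\<Sum>\<^sub># Y = s + (2 - n)" "\<Prod>\<^sub># X = \<Prod>\<^sub># Y" "size X = 2" "size Y = 2"
    by (rule admissible_sizesE)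
  obtain a b where ab: "X = {#a, b#}"
    using XY(7) by (rule size_2_msetE)
  obtain c d where cd: "Y = {#c, d#}"
    using XY(8) by (rule size_2_msetE)
  have sum: "int a + int b = int c + int d"
    using XY(4,5) ab cd by simp
  have "a * b = c * d"
    using XY(6) ab cd by simp
  then have prd: "int a * int b = int c * int d"
    by (metis of_nat_mult)
  \<comment> \<open>The monic quadratic with roots \<open>c\<close> and \<open>d\<close> is
    evaluated at \<open>a\<close>; having the same coefficients as the one with roots
    \<open>a\<close> and \<open>b\<close>, it vanishes there.\<close>
  have "(int a - int c) * (int a - int d) = int a * (int a + int b - int c - int d)
      - (int a * int b - int c * int d)"
    by (simp add: algebra_simps)
  also have "\<dots> = 0"
    using sum prd by simp
  finally have "int a = int c \<or> int a = int d"
    by simp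
  then have "a = c \<and> b = d \<or> a = d \<and> b = c"
    using sum by linarith
  then show False
    using XY(1) ab cd by (elim disjE conjE) (simp_all add: add_mset_commute)
qed

section \<open>Size 3 for every sum from 19 on\<close>

lemma three_admissible_family:
  assumes "0 < u" "u < e"
  shows "3 \<in> admissible_sizes (6 * e + u)"
proof -
  obtain v where v: "e = u + v" "0 < v"
    using assms by (metis less_imp_add_positive)
  let ?X = "{#3 * (e + u), 2 * v, e#}" and ?Y = "{#2 * (e + u), v, 3 * e#}"
  \<comment> \<open>The part \<open>3 * e\<close> separates the multisets:
    \<open>3 * (e + u)\<close> is larger, while \<open>2 * v\<close> and \<open>e\<close> are
    smaller.\<close>
  have "3 * e \<notin># ?X"
    using v assms by auto
  then have "?X \<noteq> ?Y"
    by (metis union_single_eq_member add_mset_commute)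
  then show ?thesis
    by (rule admissible_sizesI) (use v in \<open>auto simp: algebra_simps\<close>)
qed

text \<open>Every \<open>s\<close> is \<open>6 * e + u\<close> with \<open>u\<close> from 1 to 6,
  and \<open>s\<close> at least 43 forces \<open>e\<close> at least 7, so \<open>u < e\<close>.
  Below 43 the family misses ten sums, which get explicit witnesses.\<close>

lemma three_admissible:
  assumes "19 \<le> s"
  shows "3 \<in> admissible_sizes s"
proof (cases "43 \<le> s")
  case True
  \<comment> \<open>The shift by 1 moves the remainder from the range 0 to 5 into 1 to 6, since the
    family needs \<open>u\<close> positive.\<close>
  define e u where "e = (s - 1) div 6" and "u = (s - 1) mod 6 + 1"
  have "s = 6 * e + u"
    using True mult_div_mod_eq[of 6 "s - 1"] by (simp add: e_def u_def)
  moreover have "0 < u" "u \<le> 6"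
    by (simp_all add: u_def Suc_le_eq)
  ultimately have "s = 6 * e + u" "0 < u" "u < e"
    using True by linarith+
  then show ?thesis
    using three_admissible_family by simp
next
  case False
  have family: "3 \<in> admissible_sizes s" if "0 < u" "u < e" "s = 6 * e + u" for e u
    using three_admissible_family that by simp
  have "3 \<in> admissible_sizes 21"
    by (rule admissible_sizes_listI[of "[1, 8, 12]" "[2, 3, 16]"]) simp_all
  moreover have "3 \<in> admissible_sizes 22"
    by (rule admissible_sizes_listI[of "[5, 8, 9]" "[6, 6, 10]"]) simp_all
  moreover have "3 \<in> admissible_sizes 23"
    by (rule admissible_sizes_listI[of "[4, 9, 10]" "[5, 6, 12]"]) simp_all
  moreover have "3 \<in> admissible_sizes 24"
    by (rule admissible_sizes_listI[of "[2, 10, 12]" "[3, 5, 16]"]) simp_all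
  moreover have "3 \<in> admissible_sizes 28"
    by (rule admissible_sizes_listI[of "[1, 11, 16]" "[2, 4, 22]"]) simp_all
  moreover have "3 \<in> admissible_sizes 29"
    by (rule admissible_sizes_listI[of "[2, 12, 15]" "[3, 6, 20]"]) simp_all
  moreover have "3 \<in> admissible_sizes 30"
    by (rule admissible_sizes_listI[of "[3, 7, 20]" "[4, 5, 21]"]) simp_all
  moreover have "3 \<in> admissible_sizes 35"
    by (rule admissible_sizes_listI[of "[1, 14, 20]" "[2, 5, 28]"]) simp_all
  moreover have "3 \<in> admissible_sizes 36"
    by (rule admissible_sizes_listI[of "[2, 13, 21]" "[3, 7, 26]"]) simp_all
  moreover have "3 \<in> admissible_sizes 42"
    by (rule admissible_sizes_listI[of "[1, 9, 32]" "[2, 4, 36]"]) simp_all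
  ultimately have sporadic: "3 \<in> admissible_sizes s"
    if "s \<in> {21, 22, 23, 24, 28, 29, 30, 35, 36, 42}"
    using that by auto
  have "s \<in> set [19..<43]"
    using assms False by (simp only: set_upt) simp
  then consider "s \<in> {19, 25, 31, 37}" | "s \<in> {20, 26, 32, 38}" | "s \<in> {27, 33, 39}"
    | "s \<in> {34, 40}" | "s = 41" | "s \<in> {21, 22, 23, 24, 28, 29, 30, 35, 36, 42}"
    by auto
  then show ?thesis
  proof cases
    case 1
    then show ?thesis by (intro family[of 1 "s div 6"]) auto
  next
    case 2
    then show ?thesis by (intro family[of 2 "s div 6"]) auto
  next
    case 3
    then show ?thesis by (intro family[of 3 "s div 6"]) auto
  next
    case 4
    then show ?thesis by (intro family[of 4 "s div 6"]) auto
  next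
    case 5
    then show ?thesis by (intro family[of 5 6]) auto
  next
    case 6
    then show ?thesis by (rule sporadic)
  qed
qed

section \<open>The admissible pairs of sum and size\<close>

text \<open>Pairs are sum, then size; the excesses are 8, 9, 9, 12 and 15. These turn out to be the
  only failures with size at least 3 and excess at least 8.\<close>

definition exceptions :: "(nat \<times> nat) set" where
  "exceptions = {(11, 3), (12, 3), (13, 4), (15, 3), (18, 3)}"

lemma not_admissible_exceptions:
  assumes "(s, n) \<in> exceptions"
  shows "n \<notin> admissible_sizes s"
proof -
  have "\<forall>(s, n) \<in> set [(11, 3), (12, 3), (13, 4), (15, 3), (18, 3)].
      distinct (map prod_list (parts n 1 s))"
    by code_simp
  then have "distinct (map prod_list (parts n 1 s))"
    using assms unfolding exceptions_def by auto
  then show ?thesis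
    by (rule not_admissible_if_distinct)
qed

lemma admissible_sizes_iff:
  "n \<in> admissible_sizes s \<longleftrightarrow> 3 \<le> n \<and> n + 8 \<le> s \<and> (s, n) \<notin> exceptions"
proof
  assume n: "n \<in> admissible_sizes s"
  \<comment> \<open>Ensures that the truncated difference \<open>s - n\<close> is the true
    excess.\<close>
  then have "n \<le> s"
    by (rule admissible_sizesE) (use size_le_sum_mset in blast)
  then have "\<not> s - n \<le> 7"
    using not_admissible_excess_le_7[of "s - n" n] n by auto
  moreover have "\<not> n \<le> 2"
    using not_admissible_size_le_2 n by blast
  ultimately show "3 \<le> n \<and> n + 8 \<le> s \<and> (s, n) \<notin> exceptions"
    using not_admissible_exceptions n by auto
next
  assume n: "3 \<le> n \<and> n + 8 \<le> s \<and> (s, n) \<notin> exceptions"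
  define d where "d = s - n"
  have s: "s = d + n"
    using n by (simp add: d_def)
  have exc: "(d + n, n) \<notin> exceptions"
    using n s by simp
  have "n \<in> admissible_sizes (d + n)"
  proof (cases "16 \<le> d")
    case True
    then have "3 \<in> admissible_sizes (d + 3)"
      by (intro three_admissible) simp
    then show ?thesis
      by (rule admissible_sizes_mono) (use n in simp)
  next
    case False
    \<comment> \<open>For these excesses the pair of size 3 is exceptional.\<close>
    have four: "4 \<le> n" if "d \<in> {8, 9, 12, 15}"
    proof -
      have "n \<noteq> 3"
        using exc that by (auto simp: exceptions_def)
      then show ?thesis
        using n by simp
    qed
    have five: "5 \<le> n" if "d = 9"
    proof -
      have "n \<noteq> 4"
        using exc that by (auto simp: exceptions_def)
      then show ?thesis
        using four that by simp
    qed
    have "d \<in> set [8..<16]"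
      using False n s by (simp only: set_upt) simp
    then consider "d = 8" | "d = 9" | "d = 10" | "d = 11" | "d = 12" | "d = 13" | "d = 14" | "d = 15"
      by auto
    then show ?thesis
    proof cases
      case 1
      have "4 \<in> admissible_sizes (8 + 4)"
        by (rule admissible_sizes_listI[of "[1, 3, 4, 4]" "[2, 2, 2, 6]"]) simp_all
      then show ?thesis
        unfolding 1 by (rule admissible_sizes_mono) (use four 1 in simp)
    next
      case 2
      have "5 \<in> admissible_sizes (9 + 5)"
        \<comment> \<open>The pair for excess 8 with a part 2 adjoined to both sides, which raises
          the excess by 1.\<close>
        by (rule admissible_sizes_listI[of "[1, 2, 3, 4, 4]" "[2, 2, 2, 2, 6]"]) simp_all
      then show ?thesis
        unfolding 2 by (rule admissible_sizes_mono) (use five 2 in simp)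
    next
      case 3
      have "3 \<in> admissible_sizes (10 + 3)"
        by (rule admissible_sizes_listI[of "[1, 6, 6]" "[2, 2, 9]"]) simp_all
      then show ?thesis
        unfolding 3 by (rule admissible_sizes_mono) (use n in simp)
    next
      case 4
      have "3 \<in> admissible_sizes (11 + 3)"
        by (rule admissible_sizes_listI[of "[1, 5, 8]" "[2, 2, 10]"]) simp_all
      then show ?thesis
        unfolding 4 by (rule admissible_sizes_mono) (use n in simp)
    next
      case 5
      have "4 \<in> admissible_sizes (12 + 4)"
        \<comment> \<open>The pair for excess 11 with a part 2 adjoined.\<close>
        by (rule admissible_sizes_listI[of "[1, 2, 5, 8]" "[2, 2, 2, 10]"]) simp_all
      then show ?thesis
        unfolding 5 by (rule admissible_sizes_mono) (use four 5 in simp)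
    next
      case 6
      have "3 \<in> admissible_sizes (13 + 3)"
        by (rule admissible_sizes_listI[of "[2, 5, 9]" "[3, 3, 10]"]) simp_all
      then show ?thesis
        unfolding 6 by (rule admissible_sizes_mono) (use n in simp)
    next
      case 7
      have "3 \<in> admissible_sizes (14 + 3)"
        by (rule admissible_sizes_listI[of "[3, 6, 8]" "[4, 4, 9]"]) simp_all
      then show ?thesis
        unfolding 7 by (rule admissible_sizes_mono) (use n in simp)
    next
      case 8
      have "4 \<in> admissible_sizes (15 + 4)"
        \<comment> \<open>The pair for excess 11 with a part 5 adjoined, which raises the excess by
          4.\<close>
        by (rule admissible_sizes_listI[of "[1, 5, 5, 8]" "[2, 2, 5, 10]"]) simp_all
      then show ?thesis
        unfolding 8 by (rule admissible_sizes_mono) (use four 8 in simp)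
    qed
  qed
  then show "n \<in> admissible_sizes s"
    using s by simp
qed

section \<open>Counting the admissible sizes\<close>

text \<open>An executable form for the sporadic values. The excluded endpoint \<open>s - 7\<close>
  encodes \<open>n + 8 \<le> s\<close>; truncation for small \<open>s\<close> gives the empty
  list.\<close>

lemma f_eq_card: "f s = card (set (filter (\<lambda>n. (s, n) \<notin> exceptions) [3..<s - 7]))"
proof -
  have "admissible_sizes s = set (filter (\<lambda>n. (s, n) \<notin> exceptions) [3..<s - 7])"
    by (auto simp: admissible_sizes_iff)
  then show ?thesis
    by (simp add: f_def)
qed

theorem theorem2p1:
  shows "(\<forall>s. 1 \<le> s \<and> s \<le> 11 \<longrightarrow> f s = 0) \<and>
         (\<forall>s\<ge>19. int (f s) = int s - 10) \<and>
         (f 12, f 13, f 14, f 15, f 16, f 17, f 18) = (1, 2, 4, 4, 6, 7, 7)"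
proof (intro conjI allI impI)
  fix s :: nat
  assume "1 \<le> s \<and> s \<le> 11"
  \<comment> \<open>The bounds leave only sum 11 with size 3, which is exceptional.\<close>
  then have "admissible_sizes s = {}"
    by (auto simp: admissible_sizes_iff exceptions_def)
  then show "f s = 0"
    by (simp add: f_def)
next
  fix s :: nat
  assume "19 \<le> s"
  \<comment> \<open>All exceptions have sum at most 18, so the whole interval remains, with
    \<open>s - 10\<close> elements.\<close>
  then have "admissible_sizes s = {3..s - 8}"
    by (auto simp: admissible_sizes_iff exceptions_def)
  then show "int (f s) = int s - 10"
    using \<open>19 \<le> s\<close> by (simp add: f_def)
next
  show "(f 12, f 13, f 14, f 15, f 16, f 17, f 18) = (1, 2, 4, 4, 6, 7, 7)"
    unfolding f_eq_card exceptions_def by code_simp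
qed

end
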